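(* Every retract of a Cantor cube $\{0,1\}^\kappa$ or of a Tikhonov cube $[0,1]^\kappa$ ($\kappa$ any cardinal) is semi-Eberlein.
   Context: For a set $S$, $c_0(S)$ is the set of all $x\in\mathbb{R}^S$ such that for every $\varepsilon>0$ the set $\{s\in S : |x(s)|>\varepsilon\}$ is finite; $\mathbb{R}^S$ carries the product topology. A compact (Hausdorff) space $K$ is semi-Eberlein if for some set $S$ there is a topological embedding of $K$ into $\mathbb{R}^S$ such that, identifying $K$ with its image, $c_0(S)\cap K$ is dense in $K$. *)

theory Defs
  imports "HOL-Analysis.Analysis"
begin

abbreviation real_power :: "'s set \<Rightarrow> ('s \<Rightarrow> real) topology"
  where "real_power S \<equiv> product_topology (\<lambda>_. euclideanreal) S"

abbreviation cantor_cube :: "'i set \<Rightarrow> ('i \<Rightarrow> nat) topology"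
  where "cantor_cube I \<equiv> product_topology (\<lambda>_. discrete_topology {0, 1}) I"

abbreviation tikhonov_cube :: "'i set \<Rightarrow> ('i \<Rightarrow> real) topology"
  where "tikhonov_cube I \<equiv> product_topology (\<lambda>_. top_of_set {0..1}) I"

definition c0 :: "'s set \<Rightarrow> ('s \<Rightarrow> real) set"
  where "c0 S = {x \<in> topspace (real_power S). \<forall>\<epsilon>>0. finite {s \<in> S. \<bar>x s\<bar> > \<epsilon>}}"

definition semi_eberlein_embedding :: "'a topology \<Rightarrow> 's set \<Rightarrow> ('a \<Rightarrow> 's \<Rightarrow> real) \<Rightarrow> bool"
  where "semi_eberlein_embedding X S e \<longleftrightarrow>
    embedding_map X (real_power S) e \<and>
    subtopology (real_power S) (e ` topspace X) closure_of (c0 S \<inter> e ` topspace X) = e ` topspace X"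

text \<open>The index set has to be sought in a fixed type. Sets of real-valued functions on the
  space suffice: replacing each index by the corresponding coordinate function turns any
  embedding witnessing the property, with indices of any type whatsoever, into one of this
  kind; see \<open>semi_eberleinI\<close> below.\<close>

definition semi_eberlein :: "'a topology \<Rightarrow> bool"
  where "semi_eberlein X \<longleftrightarrow> compact_space X \<and> Hausdorff_space X \<and>
    (\<exists>(S :: ('a \<Rightarrow> real) set) e. semi_eberlein_embedding X S e)"

lemma semi_eberleinI:
  fixes X :: "'a topology" and S :: "'s set"
  assumes "compact_space X" "Hausdorff_space X" "semi_eberlein_embedding X S e"
  shows "semi_eberlein X"
proof -
  define E where "E = e ` topspace X"
  have emb: "embedding_map X (real_power S) e"
    and dense: "subtopology (real_power S) E closure_of (c0 S \<inter> E) = E"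
    using assms(3) by (auto simp: semi_eberlein_embedding_def E_def)
  have conte: "continuous_map X (real_power S) e"
    using emb unfolding embedding_map_def by (meson continuous_map_in_subtopology homeomorphic_imp_continuous_map)
  have inje: "inj_on e (topspace X)"
    using emb unfolding embedding_map_def by (simp add: homeomorphic_imp_injective_map)
  have eS: "e x \<in> extensional S" if "x \<in> topspace X" for x
    using conte that by (auto simp: continuous_map_def PiE_def Pi_iff)
  define c where "c = (\<lambda>s x. e x s)"
  define T where "T = c ` S"
  define p where "p = inv_into S c"
  have p: "p f \<in> S" "c (p f) = f" if "f \<in> T" for f
    using that by (auto simp: T_def p_def inv_into_into f_inv_into_f)
  have injp: "inj_on p T"
    by (metis inj_onI p(2))
  define g where "g = (\<lambda>y. \<lambda>f\<in>T. y (p f) :: real)"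
  have contg: "continuous_map (real_power S) (real_power T) g"
    unfolding continuous_map_componentwise
    by (auto simp: g_def p intro: continuous_map_product_projection)
  have ge: "(g \<circ> e) x f = f x" if "f \<in> T" for x f
    using p(2)[OF that] that by (auto simp: g_def c_def fun_eq_iff)
  have inj: "inj_on (g \<circ> e) (topspace X)"
  proof (rule inj_onI)
    fix x y assume xy: "x \<in> topspace X" "y \<in> topspace X" "(g \<circ> e) x = (g \<circ> e) y"
    have "e x s = e y s" if "s \<in> S" for s
      using ge[of "c s" x] ge[of "c s" y] xy(3) that by (simp add: T_def c_def)
    then have "e x = e y"
      using eS xy by (metis extensionalityI)
    then show "x = y"
      using inje xy by (auto dest: inj_onD)
  qed
  have cont: "continuous_map X (real_power T) (g \<circ> e)"
    using conte contg by (rule continuous_map_compose)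
  have "Hausdorff_space (real_power T)"
    by (simp add: Hausdorff_space_product_topology)
  then have 1: "embedding_map X (real_power T) (g \<circ> e)"
    using cont inj assms(1)
    by (intro continuous_imp_embedding_map)
  have gc0: "g ` c0 S \<subseteq> c0 T"
  proof
    fix z assume "z \<in> g ` c0 S"
    then obtain y where y: "y \<in> c0 S" "z = g y" by blast
    have "finite {f \<in> T. \<bar>z f\<bar> > \<epsilon>}" if "\<epsilon> > 0" for \<epsilon>
    proof (rule finite_imageD)
      have "p ` {f \<in> T. \<bar>z f\<bar> > \<epsilon>} \<subseteq> {s \<in> S. \<bar>y s\<bar> > \<epsilon>}"
        by (auto simp: y(2) g_def p)
      moreover have "finite {s \<in> S. \<bar>y s\<bar> > \<epsilon>}"
        using y(1) that by (simp add: c0_def)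
      ultimately show "finite (p ` {f \<in> T. \<bar>z f\<bar> > \<epsilon>})"
        by (rule finite_subset)
      show "inj_on p {f \<in> T. \<bar>z f\<bar> > \<epsilon>}"
        using injp by (rule inj_on_subset) auto
    qed
    then show "z \<in> c0 T"
      by (auto simp: c0_def y(2) g_def)
  qed
  have "E \<subseteq> real_power S closure_of (c0 S \<inter> E)"
    using dense closure_of_subtopology_subset[of "real_power S" E "c0 S \<inter> E"] by simp
  then have "g ` E \<subseteq> g ` (real_power S closure_of (c0 S \<inter> E))"
    by blast
  also have "\<dots> \<subseteq> real_power T closure_of (g ` (c0 S \<inter> E))"
    using contg by (simp add: continuous_map_image_closure_subset)
  also have "\<dots> \<subseteq> real_power T closure_of (c0 T \<inter> g ` E)"
    using gc0 by (intro closure_of_mono) blast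
  finally have "g ` E \<subseteq> real_power T closure_of (c0 T \<inter> g ` E)" .
  then have 2: "subtopology (real_power T) (g ` E) closure_of (c0 T \<inter> g ` E) = g ` E"
    by (simp add: closure_of_subtopology_open Int_absorb2)
  have "semi_eberlein_embedding X T (g \<circ> e)"
    using 1 2 by (simp add: semi_eberlein_embedding_def E_def image_comp)
  then show ?thesis
    using assms by (auto simp: semi_eberlein_def)
qed

lemma semi_eberlein_homeomorphic:
  fixes X :: "'a topology" and Y :: "'b topology"
  assumes "X homeomorphic_space Y" "semi_eberlein X"
  shows "semi_eberlein Y"
proof -
  obtain S :: "('a \<Rightarrow> real) set" and e where e: "semi_eberlein_embedding X S e"
    using assms(2) by (auto simp: semi_eberlein_def)
  obtain h where h: "homeomorphic_map Y X h"
    using assms(1) by (metis homeomorphic_space homeomorphic_space_sym)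
  have im: "(e \<circ> h) ` topspace Y = e ` topspace X"
    using h by (metis homeomorphic_imp_surjective_map image_comp)
  have "embedding_map Y (real_power S) (e \<circ> h)"
    using e h unfolding semi_eberlein_embedding_def embedding_map_def im
    by (auto intro: homeomorphic_map_compose)
  then have "semi_eberlein_embedding Y S (e \<circ> h)"
    using e unfolding semi_eberlein_embedding_def im by auto
  moreover have "compact_space Y" "Hausdorff_space Y"
    using assms homeomorphic_compact_space homeomorphic_Hausdorff_space
    by (auto simp: semi_eberlein_def)
  ultimately show ?thesis
    by (blast intro: semi_eberleinI)
qed

end

theory Submission
  imports Defs
begin

text \<open>Let \<open>r\<close> retract the cube onto \<open>K\<close>. Each coordinate of \<open>r\<close> depends on countably many
  coordinates only, so the index set carries a ranking \<open>\<rho>\<close> with countable fibres and values in a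
  well-order such that \<open>(r x) k\<close> is determined by the coordinates of \<open>x\<close> of rank at most \<open>\<rho> k\<close>.
  Replacing the coordinates of rank at least \<open>\<rho> k\<close> by a base point and applying \<open>r\<close> predicts the
  coordinate \<open>k\<close> of a point of \<open>K\<close> from those of smaller rank. A point of \<open>K\<close> is determined by its
  deviations from the predictions; scaling these down to a null sequence along every fibre gives
  the embedding. It sends every point deviating on finitely many fibres only into \<open>c\<^sub>0\<close>, and such
  points are dense: the projections of \<open>K\<close> to initial segments of ranks are open, and any
  partial point can be continued with the predicted values.\<close>

section \<open>Countable dependence of continuous real functions on compact products\<close>

lemma openin_product_topology_boxE:
  assumes "openin (product_topology X I) W" "x \<in> W"
  obtains U where "finite {i \<in> I. U i \<noteq> topspace (X i)}" "\<forall>i\<in>I. openin (X i) (U i)"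
    "x \<in> PiE I U" "PiE I U \<subseteq> W"
proof -
  have "\<exists>U. finite {i \<in> I. U i \<noteq> topspace (X i)} \<and> (\<forall>i\<in>I. openin (X i) (U i)) \<and>
      x \<in> PiE I U \<and> PiE I U \<subseteq> W"
    using assms(1)[unfolded openin_product_topology_alt] assms(2) by (rule bspec)
  then show ?thesis using that by blast
qed

text \<open>For each \<open>\<epsilon>\<close>, compactness gives a finite cover by basic boxes on
  which \<open>h\<close> varies by less than \<open>\<epsilon>\<close>. Together these boxes
  restrict only finitely many coordinates, and points agreeing there share a box. The union of these
  finite sets over \<open>\<epsilon> = 1/(n+1)\<close> is the required \<open>N\<close>.\<close>

lemma continuous_map_product_countable_dependence:
  fixes h :: "('i \<Rightarrow> 'a) \<Rightarrow> real"
  assumes comp: "compact_space (product_topology X I)"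
    and cont: "continuous_map (product_topology X I) euclideanreal h"
  obtains N where "countable N" "N \<subseteq> I"
    "\<And>x y. \<lbrakk>x \<in> topspace (product_topology X I); y \<in> topspace (product_topology X I);
        \<And>i. i \<in> N \<Longrightarrow> x i = y i\<rbrakk> \<Longrightarrow> h x = h y"
proof -
  let ?P = "product_topology X I"
  have "\<exists>F. finite F \<and> F \<subseteq> I \<and> (\<forall>x\<in>topspace ?P. \<forall>y\<in>topspace ?P.
      (\<forall>i\<in>F. x i = y i) \<longrightarrow> \<bar>h x - h y\<bar> < \<epsilon>)" if "\<epsilon> > 0" for \<epsilon>
  proof -
    \<comment> \<open>The bound is \<open>\<epsilon>/2\<close> because two points of one box are
      compared through its centre \<open>x\<close>.\<close>
    define box where "box x U \<longleftrightarrow> finite {i \<in> I. U i \<noteq> topspace (X i)} \<and>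
        (\<forall>i\<in>I. openin (X i) (U i)) \<and> x \<in> PiE I U \<and> (\<forall>y\<in>PiE I U. \<bar>h x - h y\<bar> < \<epsilon>/2)" for x U
    have "\<forall>x\<in>topspace ?P. \<exists>U. box x U"
    proof
      fix x assume x: "x \<in> topspace ?P"
      let ?W = "{y \<in> topspace ?P. h y \<in> ball (h x) (\<epsilon>/2)}"
      have "openin ?P ?W"
        using cont by (rule openin_continuous_map_preimage) auto
      moreover have "x \<in> ?W"
        using x \<open>\<epsilon> > 0\<close> by simp
      ultimately obtain U where U: "finite {i \<in> I. U i \<noteq> topspace (X i)}"
          "\<forall>i\<in>I. openin (X i) (U i)" "x \<in> PiE I U" "PiE I U \<subseteq> ?W"
        by (rule openin_product_topology_boxE)
      have "\<bar>h x - h y\<bar> < \<epsilon>/2" if "y \<in> PiE I U" for y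
        using subsetD[OF U(4) that] by (simp add: dist_real_def)
      then show "\<exists>U. box x U"
        using U(1-3) unfolding box_def by blast
    qed
    from bchoice[OF this] obtain U where U: "\<And>x. x \<in> topspace ?P \<Longrightarrow> box x (U x)"
      by blast
    have "\<forall>W\<in>(\<lambda>x. PiE I (U x)) ` topspace ?P. openin ?P W"
      using U by (auto simp: openin_PiE_gen box_def)
    moreover have "topspace ?P \<subseteq> \<Union> ((\<lambda>x. PiE I (U x)) ` topspace ?P)"
      using U unfolding box_def by blast
    ultimately obtain \<F> where "finite \<F>" "\<F> \<subseteq> (\<lambda>x. PiE I (U x)) ` topspace ?P"
        "topspace ?P \<subseteq> \<Union>\<F>"
      using comp unfolding compact_space_alt by meson
    then obtain C where C: "finite C" "C \<subseteq> topspace ?P"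
        "topspace ?P \<subseteq> (\<Union>x\<in>C. PiE I (U x))"
      by (metis finite_subset_image)
    \<comment> \<open>Agreement on \<open>F\<close> carries a point from one box of the cover into
      the same box: outside \<open>F\<close> no box imposes a restriction.\<close>
    define F where "F = (\<Union>x\<in>C. {i \<in> I. U x i \<noteq> topspace (X i)})"
    have "\<bar>h x - h y\<bar> < \<epsilon>"
      if x: "x \<in> topspace ?P" and y: "y \<in> topspace ?P" and eq: "\<forall>i\<in>F. x i = y i" for x y
    proof -
      obtain c where c: "c \<in> C" "x \<in> PiE I (U c)"
        using C x by blast
      have "y i \<in> U c i" if "i \<in> I" for i
      proof (cases "U c i = topspace (X i)")
        case True
        then show ?thesis using y that by auto
      next
        case False
        then have "i \<in> F" using c that by (auto simp: F_def)
        then show ?thesis using eq c that by (metis PiE_mem)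
      qed
      then have "y \<in> PiE I (U c)"
        using y by (auto simp: PiE_iff)
      moreover have "box c (U c)" using U c C by blast
      ultimately have "\<bar>h c - h x\<bar> < \<epsilon>/2" "\<bar>h c - h y\<bar> < \<epsilon>/2"
        using c unfolding box_def by blast+
      then show ?thesis by argo
    qed
    moreover have "finite F" "F \<subseteq> I"
      using C U unfolding F_def box_def by blast+
    ultimately show ?thesis by blast
  qed
  then have "\<exists>F. finite F \<and> F \<subseteq> I \<and> (\<forall>x\<in>topspace ?P. \<forall>y\<in>topspace ?P.
      (\<forall>i\<in>F. x i = y i) \<longrightarrow> \<bar>h x - h y\<bar> < inverse (real (Suc n)))" for n
    by simp
  then obtain F where F: "\<And>n. finite (F n)" "\<And>n. F n \<subseteq> I"
    and small: "\<And>n x y. \<lbrakk>x \<in> topspace ?P; y \<in> topspace ?P; \<forall>i\<in>F n. x i = y i\<rbrakk>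
      \<Longrightarrow> \<bar>h x - h y\<bar> < inverse (real (Suc n))"
    by metis
  show ?thesis
  proof
    show "countable (\<Union>n. F n)" "(\<Union>n. F n) \<subseteq> I"
      using F by (auto simp: countable_finite)
    fix x y
    assume xy: "x \<in> topspace ?P" "y \<in> topspace ?P" "\<And>i. i \<in> (\<Union>n. F n) \<Longrightarrow> x i = y i"
    have "\<bar>h x - h y\<bar> < inverse (real (Suc n))" for n
      using xy by (intro small) auto
    then have "\<not> 0 < \<bar>h x - h y\<bar>"
      using reals_Archimedean[of "\<bar>h x - h y\<bar>"] by (meson less_asym)
    then show "h x = h y"
      by simp
  qed
qed

section \<open>Ranking the indices along countable dependence\<close>

text \<open>Let \<open>B i\<close> be the closure of \<open>{i}\<close> under \<open>N\<close>, a
  countable set, and let \<open>\<rho> k\<close> be the least \<open>i\<close> with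
  \<open>k \<in> B i\<close> in a well-order of the type. The fibre over \<open>i\<close> lies in
  \<open>B i\<close>. If \<open>l \<in> N k\<close>, then \<open>l\<close> belongs to
  \<open>B (\<rho> k)\<close> as well, so its rank cannot be larger.\<close>

lemma ex_ranking:
  fixes N :: "'i \<Rightarrow> 'i set"
  assumes "\<And>k. countable (N k)"
  obtains L :: "'i rel" and \<rho> :: "'i \<Rightarrow> 'i"
  where "wf L" "trans L" "total L" "\<And>i. countable {k. \<rho> k = i}"
    "\<And>k l. l \<in> N k \<Longrightarrow> (\<rho> k, \<rho> l) \<notin> L"
proof -
  obtain r :: "'i rel" where r: "Well_order r" "Field r = UNIV"
    using well_ordering[where 'a = 'i] by metis
  define L where "L = r - Id"
  have L: "wf L" "trans L" "total L"
    using r unfolding L_def well_order_on_def linear_order_on_def partial_order_on_def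
        preorder_on_def by (auto intro: trans_diff_Id simp: total_on_diff_Id)
  define B where "B i = {(k, l). l \<in> N k}\<^sup>* `` {i}" for i
  have "countable ({(k, l). l \<in> N k} `` Y)" if "countable Y" for Y
  proof -
    have "{(k, l). l \<in> N k} `` Y = (\<Union>k\<in>Y. N k)" by auto
    then show ?thesis using assms that by simp
  qed
  then have "countable (B i)" for i
    unfolding B_def by (intro countable_rtrancl) auto
  have "\<exists>i. k \<in> B i \<and> (\<forall>j. (j, i) \<in> L \<longrightarrow> k \<notin> B j)" for k
  proof -
    have "k \<in> {i. k \<in> B i}" by (simp add: B_def)
    then obtain i where "i \<in> {i. k \<in> B i}" "\<And>j. (j, i) \<in> L \<Longrightarrow> j \<notin> {i. k \<in> B i}"
      using wfE_min[OF L(1)] by metis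
    then show ?thesis by auto
  qed
  then obtain \<rho> where \<rho>: "\<And>k. k \<in> B (\<rho> k)" "\<And>k j. (j, \<rho> k) \<in> L \<Longrightarrow> k \<notin> B j"
    by metis
  show ?thesis
  proof
    show "wf L" "trans L" "total L" by (fact L)+
    fix i show "countable {k. \<rho> k = i}"
      using \<open>countable (B i)\<close> \<rho>(1) by (rule_tac countable_subset[of _ "B i"]) auto
  next
    fix k l assume "l \<in> N k"
    then have "l \<in> B (\<rho> k)"
      using \<rho>(1)[of k] by (auto simp: B_def intro: rtrancl_into_rtrancl)
    then show "(\<rho> k, \<rho> l) \<notin> L" using \<rho>(2) by blast
  qed
qed

section \<open>Predictions from smaller ranks\<close>

text \<open>\<open>L\<close> is a strict well-order of all ranks, so
  \<open>(\<eta>, \<xi>) \<notin> L\<close> reads as \<open>\<xi> \<le> \<eta>\<close>. The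
  assumption \<open>ranked\<close> thus says that the coordinate \<open>k\<close> of
  \<open>r x\<close> depends only on coordinates of rank at most \<open>\<rho> k\<close>. The point
  \<open>a\<close> fills the coordinates that a truncation forgets.\<close>

locale ranked_retraction =
  fixes I :: "'i set" and T :: "'a topology" and K :: "('i \<Rightarrow> 'a) set"
    and r :: "('i \<Rightarrow> 'a) \<Rightarrow> 'i \<Rightarrow> 'a" and L :: "'b rel" and \<rho> :: "'i \<Rightarrow> 'b" and a :: 'a
  assumes a: "a \<in> topspace T"
    and K_subset: "K \<subseteq> topspace (product_topology (\<lambda>_. T) I)"
    and cont_r: "continuous_map (product_topology (\<lambda>_. T) I)
      (subtopology (product_topology (\<lambda>_. T) I) K) r"
    and r_id: "\<And>x. x \<in> K \<Longrightarrow> r x = x"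
    and wf: "wf L" and trans: "trans L" and total: "total L"
    and ranked: "\<And>x y k. \<lbrakk>x \<in> topspace (product_topology (\<lambda>_. T) I);
        y \<in> topspace (product_topology (\<lambda>_. T) I); k \<in> I;
        \<And>l. \<lbrakk>l \<in> I; (\<rho> k, \<rho> l) \<notin> L\<rbrakk> \<Longrightarrow> x l = y l\<rbrakk> \<Longrightarrow> r x k = r y k"
begin

abbreviation P where "P \<equiv> product_topology (\<lambda>_. T) I"

definition trunc :: "'b \<Rightarrow> ('i \<Rightarrow> 'a) \<Rightarrow> 'i \<Rightarrow> 'a"
  where "trunc \<eta> x = (\<lambda>k\<in>I. if (\<rho> k, \<eta>) \<in> L then x k else a)"

definition pred :: "('i \<Rightarrow> 'a) \<Rightarrow> 'i \<Rightarrow> 'a"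
  where "pred x k = r (trunc (\<rho> k) x) k"

text \<open>Ranks are collected rather than indices: a point with finite deviation may still differ
  from its predictions at infinitely many indices of one fibre.\<close>

definition deviation :: "('i \<Rightarrow> 'a) \<Rightarrow> 'b set"
  where "deviation x = \<rho> ` {k \<in> I. x k \<noteq> pred x k}"

lemma not_L_iff: "(\<eta>, \<xi>) \<notin> L \<longleftrightarrow> \<xi> = \<eta> \<or> (\<xi>, \<eta>) \<in> L"
  using wf total by (metis UNIV_I total_on_def wf_asym)

lemma L_trans: "\<lbrakk>(\<zeta>, \<eta>) \<in> L; (\<eta>, \<xi>) \<in> L\<rbrakk> \<Longrightarrow> (\<zeta>, \<xi>) \<in> L"
  using trans by (rule transD)

lemma r_in: "x \<in> topspace P \<Longrightarrow> r x \<in> K"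
  using cont_r by (auto simp: continuous_map_def)

lemma r_in_P: "x \<in> topspace P \<Longrightarrow> r x \<in> topspace P"
  using r_in K_subset by blast

lemma in_T: "\<lbrakk>x \<in> topspace P; k \<in> I\<rbrakk> \<Longrightarrow> x k \<in> topspace T"
  by (auto simp: PiE_iff)

lemma trunc_in: "(\<And>k. \<lbrakk>k \<in> I; (\<rho> k, \<eta>) \<in> L\<rbrakk> \<Longrightarrow> x k \<in> topspace T) \<Longrightarrow> trunc \<eta> x \<in> topspace P"
  using a by (auto simp: trunc_def PiE_iff)

lemma trunc_cong:
  "(\<And>k. \<lbrakk>k \<in> I; (\<rho> k, \<eta>) \<in> L\<rbrakk> \<Longrightarrow> x k = y k) \<Longrightarrow> trunc \<eta> x = trunc \<eta> y"
  by (auto simp: trunc_def fun_eq_iff)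

lemma pred_cong:
  "(\<And>l. \<lbrakk>l \<in> I; (\<rho> l, \<rho> k) \<in> L\<rbrakk> \<Longrightarrow> x l = y l) \<Longrightarrow> pred x k = pred y k"
  unfolding pred_def by (simp cong: trunc_cong)

lemma pred_in: "\<lbrakk>x \<in> topspace P; k \<in> I\<rbrakk> \<Longrightarrow> pred x k \<in> topspace T"
  unfolding pred_def by (intro in_T r_in_P trunc_in)

lemma continuous_map_r:
  assumes "k \<in> I"
  shows "continuous_map P T (\<lambda>x. r x k)"
proof -
  have "continuous_map P P r"
    using cont_r by (simp add: continuous_map_in_subtopology)
  then show ?thesis
    using continuous_map_compose[OF _ continuous_map_product_projection[OF assms]]
    by (fastforce simp: o_def)
qed

lemma continuous_map_pred:
  assumes "k \<in> I"
  shows "continuous_map P T (\<lambda>x. pred x k)"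
proof -
  have "continuous_map P P (trunc \<eta>)" for \<eta>
    unfolding continuous_map_componentwise
    by (auto simp: trunc_def a intro: continuous_map_product_projection)
  then have "continuous_map P T ((\<lambda>x. r x k) \<circ> trunc (\<rho> k))"
    using continuous_map_r[OF assms] by (rule continuous_map_compose)
  then show ?thesis by (simp add: pred_def o_def)
qed

section \<open>Continuing partial points by predicted values\<close>

text \<open>The set \<open>A\<close> is an initial segment in rank. Recursion on rank defines
  \<open>z\<close>, since a prediction reads smaller ranks only. Membership in \<open>K\<close>
  follows from \<open>r z = z\<close>, proved by induction on rank: up to the rank of
  \<open>k\<close>, \<open>z\<close> agrees with some \<open>w \<in> K\<close>, so
  \<open>r z k = r w k = w k = z k\<close>.\<close>

lemma ex_predicted_extension:
  assumes v: "v \<in> K" and A: "\<And>k l. \<lbrakk>k \<in> A; l \<in> I; (\<rho> k, \<rho> l) \<notin> L\<rbrakk> \<Longrightarrow> l \<in> A"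
  obtains z where "z \<in> K" "\<And>k. k \<in> I \<inter> A \<Longrightarrow> z k = v k"
    "\<And>k. k \<in> I - A \<Longrightarrow> z k = pred z k"
proof -
  \<comment> \<open>The value \<open>undefined\<close> outside \<open>I\<close> makes
    \<open>z\<close> extensional, as points of the product are.\<close>
  define G where "G = (\<lambda>g k. if k \<notin> I then undefined else if k \<in> A then v k else pred g k)"
  define z where "z = wfrec (inv_image L \<rho>) G"
  have "z k = G z k" for k
  proof -
    have "z k = G (cut z (inv_image L \<rho>) k) k"
      unfolding z_def by (rule wfrec) (simp add: wf)
    \<comment> \<open>\<open>cut\<close> alters only values at ranks not below
      \<open>\<rho> k\<close>, which the prediction at \<open>k\<close> does not read.\<close>
    also have "pred (cut z (inv_image L \<rho>) k) k = pred z k"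
      by (rule pred_cong) (simp add: cut_def)
    then have "G (cut z (inv_image L \<rho>) k) k = G z k"
      by (simp add: G_def)
    finally show ?thesis .
  qed
  then have z: "k \<notin> I \<Longrightarrow> z k = undefined" "k \<in> I \<inter> A \<Longrightarrow> z k = v k"
      "k \<in> I - A \<Longrightarrow> z k = pred z k" for k
    by (auto simp: G_def)
  have vP: "v \<in> topspace P" using v K_subset by blast
  have zT: "z k \<in> topspace T" if "k \<in> I" for k
    using wf that
  proof (induction "\<rho> k" arbitrary: k rule: wf_induct_rule)
    case less
    show ?case
    proof (cases "k \<in> A")
      case True
      then show ?thesis using z vP less by (simp add: in_T)
    next
      case False
      have "r (trunc (\<rho> k) z) k \<in> topspace T"
        using less by (intro in_T[OF r_in_P[OF trunc_in]])
      then show ?thesis using False less z by (simp add: pred_def)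
    qed
  qed
  then have zP: "z \<in> topspace P"
    using z by (auto simp: PiE_iff extensional_def)
  have "r z k = z k" if "k \<in> I" for k
    using wf that
  proof (induction "\<rho> k" arbitrary: k rule: wf_induct_rule)
    case (less k)
    \<comment> \<open>For \<open>k \<in> A\<close> the witness is \<open>v\<close>. Otherwise it is
      the image under \<open>r\<close> of the truncation of \<open>z\<close>, from which
      \<open>pred z k\<close> is read off.\<close>
    have "\<exists>w\<in>K. \<forall>l\<in>I. (\<rho> k, \<rho> l) \<notin> L \<longrightarrow> z l = w l"
    proof (cases "k \<in> A")
      case True
      then show ?thesis using v z A[OF True] by blast
    next
      case False
      define w where "w = r (trunc (\<rho> k) z)"
      have tP: "trunc (\<rho> k) z \<in> topspace P" using zT by (intro trunc_in)
      have "z l = w l" if l: "l \<in> I" "(\<rho> k, \<rho> l) \<notin> L" for l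
      proof (cases "\<rho> l = \<rho> k")
        case True
        \<comment> \<open>An index of \<open>A\<close> with the same rank as \<open>k\<close> would
          force \<open>k\<close> into \<open>A\<close>. Hence \<open>z l\<close> is a predicted
          value too, taken from the same truncation.\<close>
        then have "l \<notin> A" using A[of l k] less.prems False not_L_iff by auto
        then show ?thesis using z True l by (simp add: w_def pred_def)
      next
        case False
        then have lk: "(\<rho> l, \<rho> k) \<in> L" using l not_L_iff by blast
        have "w l = r z l"
          unfolding w_def
        proof (rule ranked[OF tP zP l(1)])
          fix m assume "m \<in> I" "(\<rho> l, \<rho> m) \<notin> L"
          then have "(\<rho> m, \<rho> k) \<in> L" using lk not_L_iff L_trans by metis
          then show "trunc (\<rho> k) z m = z m" using \<open>m \<in> I\<close> by (simp add: trunc_def)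
        qed
        then show ?thesis using less.hyps[OF lk l(1)] by simp
      qed
      then show ?thesis using r_in[OF tP] w_def by blast
    qed
    then obtain w where w: "w \<in> K" "\<And>l. \<lbrakk>l \<in> I; (\<rho> k, \<rho> l) \<notin> L\<rbrakk> \<Longrightarrow> z l = w l"
      by blast
    have "r z k = r w k"
      using w K_subset zP less.prems by (intro ranked) auto
    then show ?case using w r_id less.prems not_L_iff by metis
  qed
  then have "r z = z"
    using r_in_P[OF zP] zP by (intro ext) (metis PiE_arb topspace_product_topology)
  then have "z \<in> K" using r_in[OF zP] by simp
  then show ?thesis using that z by blast
qed

section \<open>Density of the points with finite deviation\<close>

text \<open>Induction on the largest rank \<open>\<eta>\<close> of a restricted coordinate. Pulling
  the box back along \<open>r\<close> gives a box around \<open>x\<close> in the cube. By induction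
  some \<open>z'\<close> of finite deviation meets its restrictions below \<open>\<eta>\<close>.
  Gluing \<open>z'\<close> below \<open>\<eta>\<close> to \<open>x\<close> elsewhere, applying
  \<open>r\<close>, and continuing above \<open>\<eta>\<close> by predictions adds at most the rank
  \<open>\<eta>\<close> to the deviation.\<close>

lemma finite_deviation_dense_box:
  assumes "x \<in> K" "finite F" "F \<subseteq> I" "\<And>k. k \<in> F \<Longrightarrow> openin T (U k) \<and> x k \<in> U k"
  shows "\<exists>z\<in>K. finite (deviation z) \<and> (\<forall>k\<in>F. z k \<in> U k)"
proof -
  \<comment> \<open>All boxes \<open>U\<close> are quantified because the induction replaces the
    given box by another one.\<close>
  define Q where "Q F \<longleftrightarrow> (\<forall>U. (\<forall>k\<in>F. openin T (U k) \<and> x k \<in> U k) \<longrightarrow>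
      (\<exists>z\<in>K. finite (deviation z) \<and> (\<forall>k\<in>F. z k \<in> U k)))" for F
  have xP: "x \<in> topspace P" using assms K_subset by blast
  have empty: "Q {}"
  proof -
    obtain z where "z \<in> K" "\<And>k. k \<in> I \<Longrightarrow> z k = pred z k"
      by (rule ex_predicted_extension[OF \<open>x \<in> K\<close>, of "{}"]) auto
    moreover from this have "deviation z = {}" by (auto simp: deviation_def)
    then have "finite (deviation z)" by simp
    ultimately show ?thesis unfolding Q_def by blast
  qed
  have step: "Q F" if F: "finite F" "F \<subseteq> I" and le: "\<And>k. k \<in> F \<Longrightarrow> (\<eta>, \<rho> k) \<notin> L"
    and IH: "\<And>F'. \<lbrakk>finite F'; F' \<subseteq> I; \<And>k. k \<in> F' \<Longrightarrow> (\<rho> k, \<eta>) \<in> L\<rbrakk> \<Longrightarrow> Q F'" for \<eta> F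
    unfolding Q_def
  proof (intro allI impI)
    fix U assume U: "\<forall>k\<in>F. openin T (U k) \<and> x k \<in> U k"
    define V where "V = {y \<in> topspace P. \<forall>k\<in>F. r y k \<in> U k}"
    have "openin P {y \<in> topspace P. r y k \<in> U k}" if "k \<in> F" for k
      using openin_continuous_map_preimage[OF continuous_map_r] U F that by blast
    then have "openin P ((\<Inter>k\<in>F. {y \<in> topspace P. r y k \<in> U k}) \<inter> topspace P)"
      using F(1) by (intro openin_INT)
    also have "(\<Inter>k\<in>F. {y \<in> topspace P. r y k \<in> U k}) \<inter> topspace P = V"
      by (auto simp: V_def)
    finally have "openin P V" .
    moreover have "x \<in> V"
      using U xP r_id[OF \<open>x \<in> K\<close>] by (simp add: V_def)
    ultimately obtain X where X: "finite {k \<in> I. X k \<noteq> topspace T}" "\<forall>k\<in>I. openin T (X k)"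
        "x \<in> PiE I X" "PiE I X \<subseteq> V"
      by (rule openin_product_topology_boxE)
    \<comment> \<open>Only restrictions of rank below \<open>\<eta>\<close> are handed to the
      induction. At the other ranks the glued point \<open>y\<close> takes the values of
      \<open>x\<close>, which already lie in \<open>X\<close>.\<close>
    define F' where "F' = {k \<in> I. X k \<noteq> topspace T \<and> (\<rho> k, \<eta>) \<in> L}"
    have "finite F'" using X(1) by (rule rev_finite_subset) (auto simp: F'_def)
    then have "Q F'" by (rule IH) (auto simp: F'_def)
    moreover have "\<forall>k\<in>F'. openin T (X k) \<and> x k \<in> X k"
      using X by (auto simp: F'_def)
    ultimately obtain z' where z': "z' \<in> K" "finite (deviation z')" "\<And>k. k \<in> F' \<Longrightarrow> z' k \<in> X k"
      unfolding Q_def by blast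
    have z'P: "z' \<in> topspace P" using z' K_subset by blast
    define y where "y = (\<lambda>k\<in>I. if (\<rho> k, \<eta>) \<in> L then z' k else x k)"
    have "y k \<in> X k" if "k \<in> I" for k
      using that z' X in_T[OF z'P that] by (cases "k \<in> F'") (auto simp: y_def F'_def)
    then have "y \<in> V" using X(4) by (auto simp: y_def PiE_iff)
    then have yP: "y \<in> topspace P" and rU: "\<And>k. k \<in> F \<Longrightarrow> r y k \<in> U k"
      by (auto simp: V_def)
    \<comment> \<open>\<open>r y\<close> witnesses that projecting \<open>K\<close> to the ranks below \<open>\<eta>\<close> is an open map: it agrees there
      with \<open>z'\<close> and still lies in the given box.\<close>
    have below: "r y k = z' k" if "k \<in> I" "(\<rho> k, \<eta>) \<in> L" for k
    proof -
      have "r y k = r z' k"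
      proof (rule ranked[OF yP z'P that(1)])
        fix l assume "l \<in> I" "(\<rho> k, \<rho> l) \<notin> L"
        then have "(\<rho> l, \<eta>) \<in> L"
          using that(2) not_L_iff[of "\<rho> k"] L_trans by auto
        then show "y l = z' l"
          using \<open>l \<in> I\<close> by (simp add: y_def)
      qed
      then show ?thesis by (simp add: r_id z')
    qed
    obtain z where z: "z \<in> K" "\<And>k. k \<in> I \<Longrightarrow> (\<eta>, \<rho> k) \<notin> L \<Longrightarrow> z k = r y k"
        "\<And>k. k \<in> I \<Longrightarrow> (\<eta>, \<rho> k) \<in> L \<Longrightarrow> z k = pred z k"
    proof (rule ex_predicted_extension[OF r_in[OF yP], of "{k. (\<eta>, \<rho> k) \<notin> L}"])
      fix k l assume "k \<in> {k. (\<eta>, \<rho> k) \<notin> L}" "l \<in> I" "(\<rho> k, \<rho> l) \<notin> L"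
      then show "l \<in> {k. (\<eta>, \<rho> k) \<notin> L}"
        using not_L_iff[of \<eta>] not_L_iff[of "\<rho> k"] L_trans by auto
    qed auto
    have zz': "z k = z' k" if "k \<in> I" "(\<rho> k, \<eta>) \<in> L" for k
      using z(2)[OF that(1)] below[OF that] that(2) not_L_iff[of \<eta>] by simp
    \<comment> \<open>Below \<open>\<eta>\<close> both the values and the predictions of
      \<open>z\<close> are those of \<open>z'\<close>; above \<open>\<eta>\<close> the values of
      \<open>z\<close> are the predicted ones.\<close>
    have "deviation z \<subseteq> insert \<eta> (deviation z')"
    proof
      fix \<xi> assume "\<xi> \<in> deviation z"
      then obtain k where k: "k \<in> I" "z k \<noteq> pred z k" "\<xi> = \<rho> k"
        by (auto simp: deviation_def)
      show "\<xi> \<in> insert \<eta> (deviation z')"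
      proof (cases "\<rho> k = \<eta>")
        case False
        then have lt: "(\<rho> k, \<eta>) \<in> L" using k z(3) not_L_iff by blast
        then have "pred z k = pred z' k"
          using L_trans by (intro pred_cong zz') auto
        then have "z' k \<noteq> pred z' k" using k zz' lt by metis
        then show ?thesis using k unfolding deviation_def by blast
      qed (use k in simp)
    qed
    then have "finite (deviation z)"
      using z'(2) by (meson finite_insert finite_subset)
    moreover have "\<forall>k\<in>F. z k \<in> U k"
      using z(2) rU F(2) le by (simp add: subset_iff)
    ultimately show "\<exists>z\<in>K. finite (deviation z) \<and> (\<forall>k\<in>F. z k \<in> U k)"
      using z(1) by blast
  qed
  have max: "\<exists>k\<in>F. \<forall>l\<in>F. (\<rho> k, \<rho> l) \<notin> L" if "finite F" "F \<noteq> {}" for F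
    using that
  proof (induction rule: finite_ne_induct)
    case (singleton k)
    then show ?case using not_L_iff by blast
  next
    case (insert k F)
    then show ?case using not_L_iff L_trans by (metis insert_iff)
  qed
  have below: "Q F" if "finite F" "F \<subseteq> I" "\<And>k. k \<in> F \<Longrightarrow> (\<rho> k, \<xi>) \<in> L" for \<xi> F
    using wf that
  proof (induction \<xi> arbitrary: F rule: wf_induct_rule)
    case (less \<xi>)
    show ?case
    proof (cases "F = {}")
      case False
      then obtain k where "k \<in> F" "\<forall>l\<in>F. (\<rho> k, \<rho> l) \<notin> L" using max less.prems by blast
      then show ?thesis using less by (intro step[of F "\<rho> k"]) blast+
    qed (simp add: empty)
  qed
  \<comment> \<open>There may be no rank strictly above all those in \<open>F\<close>, so
    \<open>below\<close> need not apply to \<open>F\<close> itself; it serves one further step at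
    the largest rank of \<open>F\<close>.\<close>
  have "Q F"
  proof (cases "F = {}")
    case False
    then obtain k where "k \<in> F" "\<forall>l\<in>F. (\<rho> k, \<rho> l) \<notin> L" using max assms by blast
    then show ?thesis using assms below by (intro step[of F "\<rho> k"]) blast+
  qed (simp add: empty)
  then show ?thesis using assms(4) by (auto simp: Q_def)
qed

lemma finite_deviation_dense: "K \<subseteq> P closure_of {z \<in> K. finite (deviation z)}"
proof
  fix x assume x: "x \<in> K"
  have "\<exists>z. z \<in> {z \<in> K. finite (deviation z)} \<and> z \<in> W" if W: "x \<in> W" "openin P W" for W
  proof -
    obtain X where X: "finite {k \<in> I. X k \<noteq> topspace T}" "\<forall>k\<in>I. openin T (X k)"
        "x \<in> PiE I X" "PiE I X \<subseteq> W"
      using W(2,1) by (rule openin_product_topology_boxE)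
    then obtain z where z: "z \<in> K" "finite (deviation z)"
        "\<forall>k\<in>{k \<in> I. X k \<noteq> topspace T}. z k \<in> X k"
      using finite_deviation_dense_box[OF x X(1), of X] by (auto simp: PiE_iff)
    have "z \<in> topspace P" using z K_subset by blast
    then have "z \<in> PiE I X"
      using z(3) by (auto simp: PiE_iff)
    then show ?thesis using z X by blast
  qed
  then show "x \<in> P closure_of {z \<in> K. finite (deviation z)}"
    using x K_subset by (auto simp: in_closure_of)
qed

section \<open>The embedding by scaled deviations\<close>

text \<open>The map \<open>e\<close> records the difference between value and prediction, read
  through the injection \<open>f\<close> and divided by the position in the fibre. It is injective
  because the coordinates can be recovered by induction on rank. It takes points of finite deviation
  into \<open>c0 I\<close>, and their density passes to the image by continuity.\<close>

lemma semi_eberlein_retract: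
  fixes f :: "'a \<Rightarrow> real"
  assumes comp: "compact_space T" and haus: "Hausdorff_space T"
    and f: "continuous_map T (top_of_set {0..1}) f" and inj: "inj_on f (topspace T)"
    and count: "\<And>i. countable {k \<in> I. \<rho> k = i}"
  shows "semi_eberlein (subtopology P K)"
proof -
  \<comment> \<open>\<open>n\<close> numbers each fibre injectively from 0; the successor in
    \<open>e\<close> keeps the divisor positive.\<close>
  define n where "n k = to_nat_on {l \<in> I. \<rho> l = \<rho> k} k" for k
  define e where "e x = (\<lambda>k\<in>I. (f (x k) - f (pred x k)) / real (Suc (n k)))" for x
  let ?X = "subtopology P K"
  have topX: "topspace ?X = K" using K_subset by auto
  have "Hausdorff_space ?X"
    using haus by (simp add: Hausdorff_space_subtopology Hausdorff_space_product_topology)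
  have "r ` topspace P = K"
    using r_in r_id K_subset by force
  moreover have "compact_space P"
    using comp by (simp add: compact_space_product_topology)
  then have "compactin ?X (r ` topspace P)"
    unfolding compact_space_def using cont_r by (rule image_compactin)
  ultimately have compX: "compact_space ?X"
    using topX by (simp add: compact_space_def)
  have f': "continuous_map T euclideanreal f"
    using f by (simp add: continuous_map_in_subtopology)
  have contP: "continuous_map P (real_power I) e"
    unfolding continuous_map_componentwise
  proof (intro conjI ballI)
    fix k assume k: "k \<in> I"
    have "continuous_map P euclideanreal (\<lambda>x. f (x k))"
      using continuous_map_compose[OF continuous_map_product_projection[OF k] f'] by (simp add: o_def)
    moreover have "continuous_map P euclideanreal (\<lambda>x. f (pred x k))"
      using continuous_map_compose[OF continuous_map_pred[OF k] f'] by (simp add: o_def)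
    ultimately show "continuous_map P euclideanreal (\<lambda>x. e x k)"
      using k by (auto simp: e_def intro!: continuous_intros)
  qed (auto simp: e_def)
  have "inj_on e K"
  proof (rule inj_onI)
    fix x y assume xy: "x \<in> K" "y \<in> K" "e x = e y"
    have P: "x \<in> topspace P" "y \<in> topspace P" using xy K_subset by auto
    have "x k = y k" if "k \<in> I" for k
      using wf that
    proof (induction "\<rho> k" arbitrary: k rule: wf_induct_rule)
      case less
      \<comment> \<open>Equal coordinates at smaller ranks give equal predictions, which cancel in
        \<open>e x k = e y k\<close>.\<close>
      have "pred x k = pred y k" using less by (intro pred_cong) auto
      moreover have "e x k = e y k" using xy by simp
      ultimately have "f (x k) = f (y k)" using less by (simp add: e_def)
      then show ?case
        using inj in_T[OF P(1)] in_T[OF P(2)] less.prems by (auto dest: inj_onD)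
    qed
    then show "x = y" using P unfolding topspace_product_topology by (blast intro: PiE_ext)
  qed
  then have emb: "embedding_map ?X (real_power I) e"
    using compX contP topX
    by (intro continuous_imp_embedding_map)
      (auto simp: Hausdorff_space_product_topology continuous_map_from_subtopology)
  have c0: "e z \<in> c0 I" if z: "z \<in> K" "finite (deviation z)" for z
  proof -
    have zP: "z \<in> topspace P" using z K_subset by blast
    have "finite {k \<in> I. \<bar>e z k\<bar> > \<epsilon>}" if "\<epsilon> > 0" for \<epsilon>
    proof -
      obtain m where m: "inverse (real (Suc m)) < \<epsilon>"
        using reals_Archimedean[OF \<open>\<epsilon> > 0\<close>] by blast
      show ?thesis
      proof (rule finite_subset)
        \<comment> \<open>An entry above \<open>\<epsilon>\<close> requires a deviating fibre and,
          as \<open>f\<close> has values in the unit interval, a position at most \<open>m\<close>.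
          Each of the finitely many deviating fibres has finitely many such positions.\<close>
        show "{k \<in> I. \<bar>e z k\<bar> > \<epsilon>} \<subseteq> (\<Union>i\<in>deviation z. {k \<in> {k \<in> I. \<rho> k = i}. n k \<in> {..m}})"
        proof
          fix k assume "k \<in> {k \<in> I. \<bar>e z k\<bar> > \<epsilon>}"
          then have k: "k \<in> I" "\<bar>e z k\<bar> > \<epsilon>" by auto
          then have "z k \<noteq> pred z k" using \<open>\<epsilon> > 0\<close> by (auto simp: e_def)
          then have "\<rho> k \<in> deviation z" using k by (auto simp: deviation_def)
          have "f (z k) \<in> {0..1}" "f (pred z k) \<in> {0..1}"
            using f in_T[OF zP k(1)] pred_in[OF zP k(1)] by (auto simp: continuous_map_def)
          then have "\<bar>f (z k) - f (pred z k)\<bar> \<le> 1" by auto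
          then have "\<bar>f (z k) - f (pred z k)\<bar> / real (Suc (n k)) \<le> 1 / real (Suc (n k))"
            by (intro divide_right_mono) auto
          then have "\<bar>e z k\<bar> \<le> inverse (real (Suc (n k)))"
            using k(1) by (simp add: e_def inverse_eq_divide)
          then have "inverse (real (Suc m)) < inverse (real (Suc (n k)))"
            using m k by linarith
          then have "n k \<le> m" by (simp add: field_simps)
          then show "k \<in> (\<Union>i\<in>deviation z. {k \<in> {k \<in> I. \<rho> k = i}. n k \<in> {..m}})"
            using k \<open>\<rho> k \<in> deviation z\<close> by blast
        qed
        have "inj_on n {k \<in> I. \<rho> k = i}" for i
          using inj_on_to_nat_on[OF count[of i]] by (auto simp: inj_on_def n_def)
        then have "finite {k \<in> {k \<in> I. \<rho> k = i}. n k \<in> {..m}}" for i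
          using finite_vimage_IntI[of "{..m}" n "{k \<in> I. \<rho> k = i}"]
          by (simp add: vimage_def Int_def conj_ac)
        then show "finite (\<Union>i\<in>deviation z. {k \<in> {k \<in> I. \<rho> k = i}. n k \<in> {..m}})"
          using z by blast
      qed
    qed
    then show ?thesis by (auto simp: c0_def e_def)
  qed
  have "e ` K \<subseteq> e ` (P closure_of {z \<in> K. finite (deviation z)})"
    using finite_deviation_dense by blast
  also have "\<dots> \<subseteq> real_power I closure_of (e ` {z \<in> K. finite (deviation z)})"
    using contP by (rule continuous_map_image_closure_subset)
  also have "\<dots> \<subseteq> real_power I closure_of (c0 I \<inter> e ` K)"
    using c0 by (intro closure_of_mono) blast
  finally have "subtopology (real_power I) (e ` K) closure_of (c0 I \<inter> e ` K) = e ` K"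
    by (simp add: closure_of_subtopology_open Int_absorb2)
  then have "semi_eberlein_embedding ?X I e"
    using emb topX by (simp add: semi_eberlein_embedding_def)
  then show ?thesis
    using compX \<open>Hausdorff_space ?X\<close> by (rule_tac semi_eberleinI)
qed

end

section \<open>Retracts of powers and of the two cubes\<close>

text \<open>Composing a coordinate of \<open>r\<close> with \<open>f\<close> makes it real-valued,
  so it depends on countably many coordinates; injectivity of \<open>f\<close> transfers this to the
  coordinate itself. Ranking the indices along these countable sets yields a ranked
  retraction.\<close>

lemma semi_eberlein_retract_of_power:
  fixes I :: "'i set" and T :: "'a topology" and f :: "'a \<Rightarrow> real"
  assumes comp: "compact_space T" and haus: "Hausdorff_space T" and ne: "topspace T \<noteq> {}"
    and f: "continuous_map T (top_of_set {0..1}) f" and inj: "inj_on f (topspace T)"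
    and K: "K retract_of_space (product_topology (\<lambda>_. T) I)"
  shows "semi_eberlein (subtopology (product_topology (\<lambda>_. T) I) K)"
proof -
  let ?P = "product_topology (\<lambda>_. T) I"
  obtain a where a: "a \<in> topspace T" using ne by blast
  obtain r where Ksub: "K \<subseteq> topspace ?P" and r: "continuous_map ?P (subtopology ?P K) r"
      and r_id: "\<And>x. x \<in> K \<Longrightarrow> r x = x"
    using K by (auto simp: retract_of_space_def)
  have rP: "continuous_map ?P ?P r" using r by (simp add: continuous_map_in_subtopology)
  \<comment> \<open>Countability is stated for every \<open>k\<close>, also outside
    \<open>I\<close>, because the ranking is built on the whole index type.\<close>
  have "\<exists>N. countable N \<and> (k \<in> I \<longrightarrow> N \<subseteq> I \<and> (\<forall>x\<in>topspace ?P. \<forall>y\<in>topspace ?P.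
      (\<forall>l\<in>N. x l = y l) \<longrightarrow> r x k = r y k))" for k
  proof (cases "k \<in> I")
    case True
    have rk: "continuous_map ?P T (\<lambda>x. r x k)"
      using continuous_map_compose[OF rP continuous_map_product_projection[OF True]] by (simp add: o_def)
    have "compact_space ?P"
      using comp by (simp add: compact_space_product_topology)
    moreover have "continuous_map ?P euclideanreal (\<lambda>x. f (r x k))"
      using continuous_map_compose[OF rk] f by (auto simp: continuous_map_in_subtopology o_def)
    ultimately obtain N where N: "countable N" "N \<subseteq> I"
      "\<And>x y. \<lbrakk>x \<in> topspace ?P; y \<in> topspace ?P; \<And>i. i \<in> N \<Longrightarrow> x i = y i\<rbrakk> \<Longrightarrow> f (r x k) = f (r y k)"
      by (rule continuous_map_product_countable_dependence) blast
    have "r x k \<in> topspace T" if "x \<in> topspace ?P" for x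
      using rk that by (auto simp: continuous_map_def)
    then have "r x k = r y k"
      if "x \<in> topspace ?P" "y \<in> topspace ?P" "\<forall>l\<in>N. x l = y l" for x y
      using that N(3)[of x y] inj_onD[OF inj] by blast
    then show ?thesis using N(1,2) by blast
  qed auto
  then obtain N where N: "\<And>k. countable (N k)" "\<And>k. k \<in> I \<Longrightarrow> N k \<subseteq> I"
      "\<And>k x y. \<lbrakk>k \<in> I; x \<in> topspace ?P; y \<in> topspace ?P; \<forall>l\<in>N k. x l = y l\<rbrakk> \<Longrightarrow> r x k = r y k"
    by metis
  obtain L :: "'i rel" and \<rho> :: "'i \<Rightarrow> 'i" where L: "wf L" "trans L" "total L"
      and count: "\<And>i. countable {k. \<rho> k = i}"
      and rank: "\<And>k l. l \<in> N k \<Longrightarrow> (\<rho> k, \<rho> l) \<notin> L"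
    using ex_ranking[of N] N(1) by blast
  interpret ranked_retraction I T K r L \<rho> a
  proof
    show "r x k = r y k" if "x \<in> topspace ?P" "y \<in> topspace ?P" "k \<in> I"
      "\<And>l. \<lbrakk>l \<in> I; (\<rho> k, \<rho> l) \<notin> L\<rbrakk> \<Longrightarrow> x l = y l" for x y k
      using that N(2,3) rank by (metis subsetD)
  qed (use a Ksub r r_id L in auto)
  have "countable {k \<in> I. \<rho> k = i}" for i
    using count[of i] by (rule countable_subset[rotated]) auto
  then show ?thesis
    using comp haus f inj by (intro semi_eberlein_retract)
qed

theorem corollary4p3:
  fixes I :: "'i set"
  shows "(\<forall>K. K retract_of_space cantor_cube I \<longrightarrow> semi_eberlein (subtopology (cantor_cube I) K))
    \<and> (\<forall>K. K retract_of_space tikhonov_cube I \<longrightarrow> semi_eberlein (subtopology (tikhonov_cube I) K))"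
proof (intro conjI allI impI)
  fix K :: "('i \<Rightarrow> nat) set" assume "K retract_of_space cantor_cube I"
  then show "semi_eberlein (subtopology (cantor_cube I) K)"
    \<comment> \<open>\<open>real\<close> injects the discrete two-point space into the unit
      interval.\<close>
    by (intro semi_eberlein_retract_of_power[where f = real])
      (auto simp: compact_space_discrete_topology)
next
  fix K :: "('i \<Rightarrow> real) set" assume "K retract_of_space tikhonov_cube I"
  then show "semi_eberlein (subtopology (tikhonov_cube I) K)"
    by (intro semi_eberlein_retract_of_power[where f = id])
      (auto simp: compact_space_subtopology Hausdorff_space_subtopology)
qed

end
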